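(* Let $T>R>P>S$ be real numbers with $2R>T+S$. Let $\{\pi_i:i\in I\}$ be a finite indexed collection of simple Smale plans with $\ell_i$ the separation line for $\pi_i$. Assume that for some $i^*\in I$, $\ell_{i^*}$ is a line through $(R,R)$ with slope strictly between $0$ and $1$, and that $(R,R)\notin\ell_j$ for any $j\in I\setminus\{i^*\}$. If $\ell_i$ has non-negative slope for all $i\in I$ and, in addition, $\ell_i\cap\mathcal{S}$ lies below $\ell_{i^*}$ for those $i\in I$ with $\ell_i$ horizontal, then fixation at $i^*$ is a globally stable equilibrium for the Taylor-Jonker dynamics of the competition among these plans. That is, if $\xi_{i^*}(0)>0$ then $\lim_{t\to\infty}\xi_{i^*}(t)=1$.
   Context: Let $\mathcal{S}\subset\mathbb{R}^2$ be the convex hull of $(R,R),(S,T),(T,S),(P,P)$ and $\mathrm{Switch}(x,y)=(y,x)$. A separation line is a line $\ell\subset\mathbb{R}^2$ such that $(S,T)$ and $(R,R)$ lie in one of the two closed half-planes bounded by $\ell$ while $(P,P)$ and $(T,S)$ lie in the other; such a line is never vertical. A simple Smale plan with separation line $\ell$ is a map $\pi:\mathcal{S}\to[0,1]$ with $\pi=0$ at points of $\mathcal{S}$ strictly above $\ell$ and $\pi=1$ at points of $\mathcal{S}$ strictly below $\ell$. Payoff matrix of the competition: for $i,j\in I$, $(A_{ij},A_{ji})$ is the payoff point when X plays $\pi_i$ against Y playing $\pi_j$, namely the point of intersection of $\ell_i$ and $\mathrm{Switch}(\ell_j)$ (a single point except when $\ell_i=\ell_j$ is the diagonal $\{s_X=s_Y\}$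 or $\ell_i=\ell_j$ is the line through $(S,T)$ and $(T,S)$; neither of these exceptional cases occurs under the hypotheses here). In particular $A_{i^*i^*}=R$. "Below" means strictly below. Dynamics: on the simplex $\Delta=\{\xi\in\mathbb{R}^I:\xi_i\ge0,\ \sum_i\xi_i=1\}$, put $A_{i\xi}=\sum_{j\in I}\xi_jA_{ij}$ and $A_{\xi\xi}=\sum_{i\in I}\xi_iA_{i\xi}$. The Taylor-Jonker equations are $\frac{d\xi_i}{dt}=\xi_i(A_{i\xi}-A_{\xi\xi})$, $i\in I$. Here $\xi(t)$ denotes a solution path in $\Delta$; fixation at $i^*$ is the vertex with $\xi_{i^*}=1$. *)

theory Defs
  imports "HOL-Analysis.Analysis"
begin

definition payoff_region :: "real \<Rightarrow> real \<Rightarrow> real \<Rightarrow> real \<Rightarrow> (real \<times> real) set" where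
  "payoff_region T R P S = convex hull {(R, R), (S, T), (T, S), (P, P)}"

text \<open>The two closed half-planes bounded by the line \<open>{p. a \<bullet> p = b}\<close> are interchanged by
  negating \<open>a\<close> and \<open>b\<close>, so fixing which pair of points lies on which side is no restriction.\<close>

definition separation_line :: "real \<Rightarrow> real \<Rightarrow> real \<Rightarrow> real \<Rightarrow> (real \<times> real) set \<Rightarrow> bool" where
  "separation_line T R P S l \<longleftrightarrow>
     (\<exists>a b. a \<noteq> 0 \<and> l = {p. a \<bullet> p = b} \<and>
        {(S, T), (R, R)} \<subseteq> {p. a \<bullet> p \<le> b} \<and> {(P, P), (T, S)} \<subseteq> {p. a \<bullet> p \<ge> b})"

definition has_slope :: "(real \<times> real) set \<Rightarrow> real \<Rightarrow> bool" where
  "has_slope l m \<longleftrightarrow> (\<exists>c. l = {(x, y). y = m * x + c})"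

text \<open>The next two notions are meant for non-vertical lines, where the point of \<open>l\<close> with a given
  abscissa exists and is unique.\<close>

definition strictly_above :: "(real \<times> real) set \<Rightarrow> real \<times> real \<Rightarrow> bool" where
  "strictly_above l p \<longleftrightarrow> (\<exists>y. (fst p, y) \<in> l \<and> y < snd p)"

definition strictly_below :: "(real \<times> real) set \<Rightarrow> real \<times> real \<Rightarrow> bool" where
  "strictly_below l p \<longleftrightarrow> (\<exists>y. (fst p, y) \<in> l \<and> snd p < y)"

text \<open>A plan is a map on the payoff region; its values elsewhere are irrelevant.\<close>

definition simple_smale_plan ::
  "real \<Rightarrow> real \<Rightarrow> real \<Rightarrow> real \<Rightarrow> (real \<times> real) set \<Rightarrow> (real \<times> real \<Rightarrow> real) \<Rightarrow> bool" where
  "simple_smale_plan T R P S l \<pi> \<longleftrightarrow>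
     separation_line T R P S l \<and>
     (\<forall>p \<in> payoff_region T R P S. \<pi> p \<in> {0..1}) \<and>
     (\<forall>p \<in> payoff_region T R P S. strictly_above l p \<longrightarrow> \<pi> p = 0) \<and>
     (\<forall>p \<in> payoff_region T R P S. strictly_below l p \<longrightarrow> \<pi> p = 1)"

text \<open>The payoff point \<open>(A i j, A j i)\<close> is the intersection point of \<open>l i\<close> with the image of \<open>l j\<close>
  under the switch map \<open>prod.swap\<close>; \<open>payoff_matrix_eqI\<close> shows that the definition
  below recovers both coordinates whenever the intersection is a single point.\<close>

definition payoff_matrix :: "('i \<Rightarrow> (real \<times> real) set) \<Rightarrow> 'i \<Rightarrow> 'i \<Rightarrow> real" where
  "payoff_matrix l i j = fst (THE p. p \<in> l i \<inter> prod.swap ` l j)"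

lemma payoff_matrix_eqI:
  assumes "l i \<inter> prod.swap ` l j = {(a, b)}"
  shows "payoff_matrix l i j = a" and "payoff_matrix l j i = b"
proof -
  have "l j \<inter> prod.swap ` l i = prod.swap ` (l i \<inter> prod.swap ` l j)"
    by (force simp: image_iff)
  then have "l j \<inter> prod.swap ` l i = {(b, a)}"
    using assms by simp
  then show "payoff_matrix l i j = a" "payoff_matrix l j i = b"
    using assms by (simp_all add: payoff_matrix_def)
qed

text \<open>Vectors of \<open>\<real>\<^sup>I\<close> are functions, of which only the values on \<open>I\<close> matter.\<close>

definition simplex_on :: "'i set \<Rightarrow> ('i \<Rightarrow> real) set" where
  "simplex_on I = {\<xi>. (\<forall>i\<in>I. 0 \<le> \<xi> i) \<and> (\<Sum>i\<in>I. \<xi> i) = 1}"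

definition payoff_against :: "'i set \<Rightarrow> ('i \<Rightarrow> 'i \<Rightarrow> real) \<Rightarrow> 'i \<Rightarrow> ('i \<Rightarrow> real) \<Rightarrow> real" where
  "payoff_against I A i \<xi> = (\<Sum>j\<in>I. \<xi> j * A i j)"

definition mean_payoff :: "'i set \<Rightarrow> ('i \<Rightarrow> 'i \<Rightarrow> real) \<Rightarrow> ('i \<Rightarrow> real) \<Rightarrow> real" where
  "mean_payoff I A \<xi> = (\<Sum>i\<in>I. \<xi> i * payoff_against I A i \<xi>)"

definition taylor_jonker :: "'i set \<Rightarrow> ('i \<Rightarrow> 'i \<Rightarrow> real) \<Rightarrow> ('i \<Rightarrow> real) \<Rightarrow> 'i \<Rightarrow> real" where
  "taylor_jonker I A \<xi> i = \<xi> i * (payoff_against I A i \<xi> - mean_payoff I A \<xi>)"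

definition taylor_jonker_solution ::
  "'i set \<Rightarrow> ('i \<Rightarrow> 'i \<Rightarrow> real) \<Rightarrow> (real \<Rightarrow> 'i \<Rightarrow> real) \<Rightarrow> bool" where
  "taylor_jonker_solution I A \<xi> \<longleftrightarrow>
     (\<forall>t\<ge>0. \<xi> t \<in> simplex_on I \<and>
        (\<forall>i\<in>I. ((\<lambda>s. \<xi> s i) has_real_derivative taylor_jonker I A (\<xi> t) i) (at t within {0..})))"

definition taylor_jonker_equilibrium ::
  "'i set \<Rightarrow> ('i \<Rightarrow> 'i \<Rightarrow> real) \<Rightarrow> ('i \<Rightarrow> real) \<Rightarrow> bool" where
  "taylor_jonker_equilibrium I A \<xi> \<longleftrightarrow>
     \<xi> \<in> simplex_on I \<and> (\<forall>i\<in>I. taylor_jonker I A \<xi> i = 0)"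

definition fixation :: "'i \<Rightarrow> 'i \<Rightarrow> real" where
  "fixation k = (\<lambda>i. if i = k then 1 else 0)"

end

theory Submission
  imports Defs
begin

text \<open>
  A separation line of slope \<open>0 \<le> m < 1\<close> meets the diagonal in a single point \<open>(v, v)\<close> with
  \<open>P \<le> v \<le> R\<close>.  Solving for the intersection with a switched line shows that the payoff \<open>A i j\<close>
  is a weighted mean of \<open>v i\<close> and \<open>v j\<close>, in which \<open>v i\<close> has a weight that vanishes
  only if line \<open>j\<close> is horizontal.  The distinguished plan \<open>k\<close> is the one with the top value
  \<open>v k = R\<close>.

  Plan \<open>k\<close> need not dominate every competitor, but it does so relative to those that are at least
  as good: if \<open>v i \<le> v j\<close>, then \<open>A i j \<le> v j \<le> A k j\<close>, because the left-hand side averages \<open>v j\<close>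
  with a value that is no larger and the right-hand side averages it with \<open>R\<close>, which is no
  smaller.  This suggests eliminating the plans in the order of increasing \<open>v\<close>: once all plans with a smaller value have
  nearly died out, plan \<open>i\<close> does no better than \<open>k\<close>, and the ratio of the two shares,
  whose logarithmic derivative is the difference of their payoffs, falls.

  For this ratio to tend to zero the payoff gap must stay away from zero.  The inequality
  \<open>A i j < A k j\<close> holds for \<open>i \<noteq> k\<close> unless line \<open>j\<close> is horizontal, since a horizontal opponent concedes the
  same payoff to everyone.  So the mass on the plans that are not horizontal has to be bounded below,
  and this is where the hypothesis on horizontal lines enters.  A horizontal line \<open>h\<close> lies below
  line \<open>k\<close> inside the payoff region, so \<open>k\<close> dominates \<open>h\<close> against every opponent.  Hence \<open>h\<close>
  never gains on \<open>k\<close>, and the horizontal plans together hold at most a fixed multiple of the share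
  of \<open>k\<close>.

  The dynamical half of the argument is \<open>ranked_elimination\<close>, which holds for any payoff matrix with
  these inequalities; the geometric half is \<open>payoff_matrix_diagonal_line\<close> together with
  \<open>horizontal_response_in_region\<close>.
\<close>

section \<open>Replicator dynamics and domination\<close>

lemma simplex_on_bounds:
  assumes "finite I" "x \<in> simplex_on I" "i \<in> I"
  shows "0 \<le> x i" "x i \<le> 1"
proof -
  have *: "\<forall>j\<in>I. 0 \<le> x j" "(\<Sum>j\<in>I. x j) = 1"
    using assms(2) by (auto simp: simplex_on_def)
  show "0 \<le> x i" using * assms(3) by blast
  show "x i \<le> 1" using member_le_sum[of i I x] * assms by auto
qed

lemma fixation_equilibrium:
  assumes "finite I" "k \<in> I"
  shows "taylor_jonker_equilibrium I A (fixation k)"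
  using assms
  by (simp add: taylor_jonker_equilibrium_def simplex_on_def fixation_def taylor_jonker_def
      mean_payoff_def payoff_against_def sum.delta if_distrib[of "\<lambda>u. u * _"] cong: if_cong)

text \<open>Solutions have one-sided derivatives at time \<open>0\<close>, so the monotonicity criterion is needed
  for derivatives within \<open>{0..}\<close>.\<close>

lemma mono_of_nonneg_derivative:
  fixes f :: "real \<Rightarrow> real"
  assumes "0 \<le> s" "s \<le> t"
    and der: "\<And>r. 0 \<le> r \<Longrightarrow> (f has_real_derivative f' r) (at r within {0..})"
    and nonneg: "\<And>r. s \<le> r \<Longrightarrow> r \<le> t \<Longrightarrow> 0 \<le> f' r"
  shows "f s \<le> f t"
proof (rule DERIV_nonneg_imp_increasing_open[OF assms(2)])
  fix r assume r: "s < r" "r < t"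
  have "at r within {0..} = at r"
    using r assms(1) by (intro at_within_interior) auto
  then show "\<exists>y. DERIV f r :> y \<and> 0 \<le> y"
    using der[of r] nonneg[of r] r assms(1) by auto
next
  have "continuous_on {0..} f"
    using der by (intro DERIV_continuous_on) auto
  then show "continuous_on {s..t} f"
    by (rule continuous_on_subset) (use assms(1) in auto)
qed

lemma taylor_jonker_solutionD:
  assumes "taylor_jonker_solution I A \<xi>" "0 \<le> t"
  shows "\<xi> t \<in> simplex_on I"
    and "i \<in> I \<Longrightarrow>
      ((\<lambda>s. \<xi> s i) has_real_derivative taylor_jonker I A (\<xi> t) i) (at t within {0..})"
  using assms by (auto simp: taylor_jonker_solution_def)

lemma payoff_against_bound:
  assumes "finite I" "x \<in> simplex_on I"
  shows "\<bar>payoff_against I A i x\<bar> \<le> (\<Sum>j\<in>I. \<bar>A i j\<bar>)"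
proof -
  have "\<bar>payoff_against I A i x\<bar> \<le> (\<Sum>j\<in>I. \<bar>x j * A i j\<bar>)"
    unfolding payoff_against_def by (rule sum_abs)
  also have "\<dots> \<le> (\<Sum>j\<in>I. \<bar>A i j\<bar>)"
    using simplex_on_bounds[OF assms]
    by (intro sum_mono) (auto simp: abs_mult intro: mult_left_le_one_le)
  finally show ?thesis .
qed

lemma mean_payoff_bound:
  assumes "finite I" "x \<in> simplex_on I"
  shows "\<bar>mean_payoff I A x\<bar> \<le> (\<Sum>i\<in>I. \<Sum>j\<in>I. \<bar>A i j\<bar>)"
proof -
  have "\<bar>mean_payoff I A x\<bar> \<le> (\<Sum>i\<in>I. \<bar>x i * payoff_against I A i x\<bar>)"
    unfolding mean_payoff_def by (rule sum_abs)
  also have "\<dots> \<le> (\<Sum>i\<in>I. \<Sum>j\<in>I. \<bar>A i j\<bar>)"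
  proof (rule sum_mono)
    fix i assume "i \<in> I"
    then have "\<bar>x i * payoff_against I A i x\<bar> \<le> \<bar>payoff_against I A i x\<bar>"
      using simplex_on_bounds[OF assms, of i] by (auto simp: abs_mult intro: mult_left_le_one_le)
    then show "\<bar>x i * payoff_against I A i x\<bar> \<le> (\<Sum>j\<in>I. \<bar>A i j\<bar>)"
      using payoff_against_bound[OF assms, of A i] by linarith
  qed
  finally show ?thesis .
qed

text \<open>The growth rate of a share is bounded by some \<open>K\<close>, so the share decays at most like
  \<open>exp (- K t)\<close>.  This makes the ratios of shares to the share of \<open>k\<close> well defined.\<close>

lemma solution_stays_positive:
  assumes "finite I" "taylor_jonker_solution I A \<xi>" "k \<in> I" "\<xi> 0 k > 0" "0 \<le> t"
  shows "\<xi> t k > 0"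
proof -
  define K where "K = (\<Sum>j\<in>I. \<bar>A k j\<bar>) + (\<Sum>i\<in>I. \<Sum>j\<in>I. \<bar>A i j\<bar>)"
  define g where "g s = payoff_against I A k (\<xi> s) - mean_payoff I A (\<xi> s)" for s
  have g: "0 \<le> g s + K" if "0 \<le> s" for s
    using payoff_against_bound[OF assms(1) taylor_jonker_solutionD(1)[OF assms(2) that], of A k]
      mean_payoff_bound[OF assms(1) taylor_jonker_solutionD(1)[OF assms(2) that], of A]
    unfolding g_def K_def by linarith
  have "\<xi> 0 k * exp (K * 0) \<le> \<xi> t k * exp (K * t)"
  proof (rule mono_of_nonneg_derivative[where f = "\<lambda>s. \<xi> s k * exp (K * s)" and f' = "\<lambda>s. \<xi> s k * exp (K * s) * (g s + K)"])
    fix s :: real assume s: "0 \<le> s"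
    show "((\<lambda>s. \<xi> s k * exp (K * s)) has_real_derivative \<xi> s k * exp (K * s) * (g s + K))
        (at s within {0..})"
      by (rule derivative_eq_intros taylor_jonker_solutionD(2)[OF assms(2) s assms(3)] refl)+
        (simp add: taylor_jonker_def g_def algebra_simps)
  next
    fix s :: real assume "0 \<le> s" "s \<le> t"
    then show "0 \<le> \<xi> s k * exp (K * s) * (g s + K)"
      using g[of s]
        simplex_on_bounds(1)[OF assms(1) taylor_jonker_solutionD(1)[OF assms(2)] assms(3)] by simp
  qed (use assms in auto)
  then have "0 < \<xi> t k * exp (K * t)"
    using assms(4) by simp
  then show ?thesis by (simp add: zero_less_mult_iff)
qed

text \<open>The mean payoff, which depends on the whole population quadratically, cancels in ratios.\<close>

lemma ratio_derivative:
  assumes "finite I" "taylor_jonker_solution I A \<xi>" "k \<in> I" "i \<in> I" "\<xi> 0 k > 0" "0 \<le> t"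
  shows "((\<lambda>s. \<xi> s i / \<xi> s k) has_real_derivative
      \<xi> t i / \<xi> t k * (payoff_against I A i (\<xi> t) - payoff_against I A k (\<xi> t))) (at t within {0..})"
proof -
  have pos: "\<xi> t k > 0"
    by (rule solution_stays_positive[OF assms(1-3,5,6)])
  note D = taylor_jonker_solutionD(2)[OF assms(2) assms(6)]
  have "((\<lambda>s. \<xi> s i / \<xi> s k) has_real_derivative
      (taylor_jonker I A (\<xi> t) i * \<xi> t k - \<xi> t i * taylor_jonker I A (\<xi> t) k)
        / (\<xi> t k * \<xi> t k)) (at t within {0..})"
    by (rule DERIV_divide[OF D[OF assms(4)] D[OF assms(3)]]) (use pos in simp)
  also have "taylor_jonker I A (\<xi> t) i * \<xi> t k - \<xi> t i * taylor_jonker I A (\<xi> t) k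
      = \<xi> t i * (payoff_against I A i (\<xi> t) - payoff_against I A k (\<xi> t)) * \<xi> t k"
    unfolding taylor_jonker_def by algebra
  also have "\<dots> / (\<xi> t k * \<xi> t k)
      = \<xi> t i / \<xi> t k * (payoff_against I A i (\<xi> t) - payoff_against I A k (\<xi> t))"
    using pos by simp
  finally show ?thesis .
qed

lemma dominated_ratio_le_initial:
  assumes "finite I" "taylor_jonker_solution I A \<xi>" "k \<in> I" "i \<in> I" "\<xi> 0 k > 0" "0 \<le> t"
    and dom: "\<And>j. j \<in> I \<Longrightarrow> A i j \<le> A k j"
  shows "\<xi> t i / \<xi> t k \<le> \<xi> 0 i / \<xi> 0 k"
proof -
  have "- (\<xi> 0 i / \<xi> 0 k) \<le> - (\<xi> t i / \<xi> t k)"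
  proof (rule mono_of_nonneg_derivative[OF order_refl assms(6)])
    show "((\<lambda>s. - (\<xi> s i / \<xi> s k)) has_real_derivative
        - (\<xi> r i / \<xi> r k * (payoff_against I A i (\<xi> r) - payoff_against I A k (\<xi> r))))
        (at r within {0..})" if "0 \<le> r" for r
      using DERIV_minus[OF ratio_derivative[OF assms(1-5) that]] .
    show "0 \<le> - (\<xi> r i / \<xi> r k * (payoff_against I A i (\<xi> r) - payoff_against I A k (\<xi> r)))"
      if "0 \<le> r" for r
    proof -
      note sim = taylor_jonker_solutionD(1)[OF assms(2) that]
      have "payoff_against I A i (\<xi> r) \<le> payoff_against I A k (\<xi> r)"
        unfolding payoff_against_def
        using simplex_on_bounds(1)[OF assms(1) sim] dom by (intro sum_mono mult_left_mono) auto
      moreover have "0 \<le> \<xi> r i / \<xi> r k"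
        using simplex_on_bounds(1)[OF assms(1) sim] assms(3,4) by simp
      ultimately have "\<xi> r i / \<xi> r k * (payoff_against I A i (\<xi> r) - payoff_against I A k (\<xi> r)) \<le> 0"
        by (intro mult_nonneg_nonpos) auto
      then show ?thesis by simp
    qed
  qed
  then show ?thesis by simp
qed

text \<open>A payoff deficit of at least \<open>d\<close> makes the ratio to the share of \<open>k\<close> times \<open>exp (d t)\<close>
  nonincreasing, and a share is at most its ratio to another share.\<close>

lemma uniformly_beaten_dies_out:
  assumes "finite I" "taylor_jonker_solution I A \<xi>" "k \<in> I" "i \<in> I" "\<xi> 0 k > 0"
    and "0 < d"
    and beaten: "eventually (\<lambda>t. payoff_against I A i (\<xi> t) + d \<le> payoff_against I A k (\<xi> t)) at_top"
  shows "((\<lambda>t. \<xi> t i) \<longlongrightarrow> 0) at_top"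
proof -
  obtain s0 where s0: "\<And>t. s0 \<le> t \<Longrightarrow>
      payoff_against I A i (\<xi> t) + d \<le> payoff_against I A k (\<xi> t)"
    using beaten by (auto simp: eventually_at_top_linorder)
  define s where "s = max 0 s0"
  define u where "u t = \<xi> t i / \<xi> t k" for t
  have xi: "0 \<le> \<xi> t j \<and> \<xi> t j \<le> 1" if "0 \<le> t" "j \<in> I" for t j
    using simplex_on_bounds[OF assms(1) taylor_jonker_solutionD(1)[OF assms(2) that(1)] that(2)]
    by simp
  have bound: "\<xi> t i \<le> u s * exp (d * s) * exp (- (d * t))" if t: "s \<le> t" for t
  proof -
    have s: "0 \<le> s" by (simp add: s_def)
    have "- (u s * exp (d * s)) \<le> - (u t * exp (d * t))"
    proof (rule mono_of_nonneg_derivative[OF s t])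
      show "((\<lambda>r. - (u r * exp (d * r))) has_real_derivative
          u r * exp (d * r) * (payoff_against I A k (\<xi> r) - payoff_against I A i (\<xi> r) - d))
          (at r within {0..})" if "0 \<le> r" for r
      proof -
        have Du: "(u has_real_derivative
            u r * (payoff_against I A i (\<xi> r) - payoff_against I A k (\<xi> r))) (at r within {0..})"
          using ratio_derivative[OF assms(1-5) that] by (simp add: u_def[abs_def])
        have De: "((\<lambda>r. exp (d * r)) has_real_derivative exp (d * r) * d) (at r within {0..})"
          by (rule derivative_eq_intros refl)+ simp
        show ?thesis
          by (rule DERIV_cong[OF DERIV_minus[OF DERIV_mult[OF Du De]]]) (simp add: algebra_simps)
      qed
      show "0 \<le> u r * exp (d * r) * (payoff_against I A k (\<xi> r) - payoff_against I A i (\<xi> r) - d)"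
        if "s \<le> r" for r
      proof -
        have "0 \<le> r" "s0 \<le> r" using that by (auto simp: s_def)
        then have "0 \<le> u r" "d \<le> payoff_against I A k (\<xi> r) - payoff_against I A i (\<xi> r)"
          using xi[of r i] xi[of r k] assms(3,4) s0[of r] by (auto simp: u_def)
        then show ?thesis by simp
      qed
    qed
    then have "u t * exp (d * t) * exp (- (d * t)) \<le> u s * exp (d * s) * exp (- (d * t))"
      by (intro mult_right_mono) auto
    then have "u t \<le> u s * exp (d * s) * exp (- (d * t))"
      by (simp only: mult.assoc exp_minus_inverse mult_1_right)
    moreover have "\<xi> t i \<le> u t"
    proof -
      have "0 < \<xi> t k"
        using solution_stays_positive[OF assms(1-3,5)] s t by simp
      then show ?thesis
        using xi[of t i] xi[of t k] s t assms(3,4)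
        by (auto simp: u_def le_divide_eq mult_left_le)
    qed
    ultimately show ?thesis by linarith
  qed
  have "filterlim (\<lambda>t. d * t) at_top at_top"
    by (rule filterlim_tendsto_pos_mult_at_top[OF tendsto_const assms(6) filterlim_ident])
  then have "filterlim (\<lambda>t. - (d * t)) at_bot at_top"
    by (simp add: filterlim_uminus_at_bot)
  then have "((\<lambda>t. exp (- (d * t))) \<longlongrightarrow> 0) at_top"
    by (rule filterlim_compose[OF exp_at_bot])
  from tendsto_mult[OF tendsto_const[of "u s * exp (d * s)"] this]
  have lim: "((\<lambda>t. u s * exp (d * s) * exp (- (d * t))) \<longlongrightarrow> 0) at_top"
    by simp
  show ?thesis
  proof (rule tendsto_sandwich[OF _ _ tendsto_const lim])
    show "\<forall>\<^sub>F t in at_top. 0 \<le> \<xi> t i"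
      using eventually_ge_at_top[of 0] by eventually_elim (use xi assms(4) in blast)
    show "\<forall>\<^sub>F t in at_top. \<xi> t i \<le> u s * exp (d * s) * exp (- (d * t))"
      using eventually_ge_at_top[of s] by eventually_elim (rule bound)
  qed
qed

text \<open>Each dominated plan keeps at most its initial ratio to \<open>k\<close>.  If these ratios sum to \<open>C\<close>, the
  dominated plans hold at most \<open>C\<close> times the share of \<open>k\<close>, and \<open>k\<close> belongs to the rest of the
  population, which therefore has mass at least \<open>1 / (1 + C)\<close>.\<close>

lemma dominated_set_leaves_mass:
  assumes fin: "finite I" and sol: "taylor_jonker_solution I A \<xi>" and k: "k \<in> I" "k \<notin> H"
    and k0: "\<xi> 0 k > 0"
    and dom: "\<And>h j. h \<in> I \<inter> H \<Longrightarrow> j \<in> I \<Longrightarrow> A h j \<le> A k j"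
  obtains d where "0 < d" "\<And>t. 0 \<le> t \<Longrightarrow> d \<le> (\<Sum>j\<in>I - H. \<xi> t j)"
proof
  define C where "C = (\<Sum>h\<in>I \<inter> H. \<xi> 0 h / \<xi> 0 k)"
  have xi: "0 \<le> \<xi> t j" if "0 \<le> t" "j \<in> I" for t j
    using simplex_on_bounds(1)[OF fin taylor_jonker_solutionD(1)[OF sol that(1)] that(2)] .
  have C: "0 \<le> C"
    unfolding C_def using xi[of 0] k0 by (intro sum_nonneg) auto
  then show "0 < 1 / (1 + C)" by simp
  fix t :: real assume t: "0 \<le> t"
  have pos: "0 < \<xi> t k"
    using solution_stays_positive[OF fin sol k(1) k0 t] .
  have "(\<Sum>h\<in>I \<inter> H. \<xi> t h) \<le> (\<Sum>h\<in>I \<inter> H. \<xi> 0 h / \<xi> 0 k * \<xi> t k)"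
  proof (rule sum_mono)
    fix h assume h: "h \<in> I \<inter> H"
    have "\<xi> t h / \<xi> t k \<le> \<xi> 0 h / \<xi> 0 k"
      using dominated_ratio_le_initial[OF fin sol k(1) _ k0 t] h dom by blast
    then show "\<xi> t h \<le> \<xi> 0 h / \<xi> 0 k * \<xi> t k"
      using pos by (simp add: pos_divide_le_eq)
  qed
  also have "\<dots> = C * \<xi> t k" by (simp add: C_def sum_distrib_right)
  also have "\<dots> \<le> C * (\<Sum>j\<in>I - H. \<xi> t j)"
    using C k fin xi[OF t] by (intro mult_left_mono member_le_sum) auto
  finally have "(\<Sum>h\<in>I \<inter> H. \<xi> t h) \<le> C * (\<Sum>j\<in>I - H. \<xi> t j)" .
  moreover have "(\<Sum>h\<in>I \<inter> H. \<xi> t h) + (\<Sum>j\<in>I - H. \<xi> t j) = 1"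
    using taylor_jonker_solutionD(1)[OF sol t] sum.Int_Diff[OF fin, of "\<xi> t" H]
    by (simp add: simplex_on_def)
  ultimately have "1 \<le> (1 + C) * (\<Sum>j\<in>I - H. \<xi> t j)" by (simp add: algebra_simps)
  then show "1 / (1 + C) \<le> (\<Sum>j\<in>I - H. \<xi> t j)"
    using C by (simp add: divide_le_eq mult.commute)
qed

text \<open>Plans are ranked by \<open>v\<close>, and \<open>H\<close> is the set of opponents against whom the advantage of \<open>k\<close>
  may degenerate.  The plans other than \<open>k\<close> die out by induction on the number of lower-ranked plans:
  the payoff gap between \<open>k\<close> and \<open>i\<close> receives a contribution that is eventually at least a
  positive constant from the opponents outside \<open>H\<close> that rank at least as high as \<open>i\<close>, a
  nonnegative one from those in \<open>H\<close> that do, and a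
  possibly negative but vanishing one from the lower-ranked opponents, which have died out already.\<close>

lemma ranked_elimination:
  fixes v :: "'i \<Rightarrow> real"
  assumes fin: "finite I" and sol: "taylor_jonker_solution I A \<xi>" and k: "k \<in> I" "k \<notin> H"
    and k0: "\<xi> 0 k > 0"
    and top: "\<And>i. i \<in> I \<Longrightarrow> v i \<le> v k"
    and weak: "\<And>i j. i \<in> I - {k} \<Longrightarrow> j \<in> I \<Longrightarrow> v i \<le> v j \<Longrightarrow> A i j \<le> A k j"
    and strict: "\<And>i j. i \<in> I - {k} \<Longrightarrow> j \<in> I - H \<Longrightarrow> v i \<le> v j \<Longrightarrow> A i j < A k j"
    and dom: "\<And>h j. h \<in> I \<inter> H \<Longrightarrow> j \<in> I \<Longrightarrow> A h j \<le> A k j"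
  shows "((\<lambda>t. \<xi> t k) \<longlongrightarrow> 1) at_top"
proof -
  obtain d where d: "0 < d" and mass: "\<And>t. 0 \<le> t \<Longrightarrow> d \<le> (\<Sum>j\<in>I - H. \<xi> t j)"
    using dominated_set_leaves_mass[OF fin sol k k0 dom] by metis
  have vanish: "((\<lambda>t. \<xi> t i) \<longlongrightarrow> 0) at_top" if "i \<in> I - {k}" for i
    using that
  proof (induction "card {j \<in> I. v j < v i}" arbitrary: i rule: less_induct)
    case less
    define E where "E = {j \<in> I. v j < v i}"
    have "E \<subseteq> I" by (auto simp: E_def)
    have "((\<lambda>t. \<xi> t j) \<longlongrightarrow> 0) at_top" if "j \<in> E" for j
    proof (rule less.hyps)
      have "{j' \<in> I. v j' < v j} \<subset> {j' \<in> I. v j' < v i}"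
        using that by (force simp: E_def)
      then show "card {j' \<in> I. v j' < v j} < card {j' \<in> I. v j' < v i}"
        using fin by (intro psubset_card_mono) auto
      show "j \<in> I - {k}"
        using that top[of i] less.prems by (auto simp: E_def)
    qed
    then have E0: "((\<lambda>t. \<Sum>j\<in>E. \<xi> t j) \<longlongrightarrow> 0) at_top"
      using tendsto_null_sum[of E "\<lambda>t j. \<xi> t j"] by blast
    \<comment> \<open>The smallest strict advantage; the \<open>1\<close> only ensures that the minimum is over a nonempty set.\<close>
    define c where "c = Min (insert 1 ((\<lambda>j. A k j - A i j) ` (I - H - E)))"
    have c: "0 < c" "\<And>j. j \<in> I - H - E \<Longrightarrow> c \<le> A k j - A i j"
      using fin strict[OF less.prems] unfolding c_def by (auto simp: E_def not_less)
    define K where "K = (\<Sum>j\<in>I. \<bar>A k j - A i j\<bar>)"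
    have K: "- K \<le> A k j - A i j" if "j \<in> I" for j
      using member_le_sum[of j I "\<lambda>j. \<bar>A k j - A i j\<bar>"] fin that unfolding K_def by auto
    have gap: "c * d - (c + K) * (\<Sum>j\<in>E. \<xi> t j)
        \<le> payoff_against I A k (\<xi> t) - payoff_against I A i (\<xi> t)" if t: "0 \<le> t" for t
    proof -
      have xi: "0 \<le> \<xi> t j" if "j \<in> I" for j
        using simplex_on_bounds(1)[OF fin taylor_jonker_solutionD(1)[OF sol t] that] .
      have "c * d \<le> c * (\<Sum>j\<in>I - H. \<xi> t j)"
        using mass[OF t] c(1) by simp
      then have "c * d - (c + K) * (\<Sum>j\<in>E. \<xi> t j)
          \<le> c * (\<Sum>j\<in>I - H. \<xi> t j) - (c + K) * (\<Sum>j\<in>E. \<xi> t j)"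
        by simp
      also have "\<dots> = (\<Sum>j\<in>I. (if j \<notin> H then c * \<xi> t j else 0) - (if j \<in> E then (c + K) * \<xi> t j else 0))"
      proof -
        have "(\<Sum>j\<in>I - H. c * \<xi> t j) = (\<Sum>j\<in>I. if j \<notin> H then c * \<xi> t j else 0)"
          using fin by (intro sum.mono_neutral_cong_left) auto
        moreover have "(\<Sum>j\<in>E. (c + K) * \<xi> t j) = (\<Sum>j\<in>I. if j \<in> E then (c + K) * \<xi> t j else 0)"
          using fin \<open>E \<subseteq> I\<close> by (intro sum.mono_neutral_cong_left) auto
        ultimately show ?thesis
          by (simp only: sum_subtractf sum_distrib_left)
      qed
      also have "\<dots> \<le> (\<Sum>j\<in>I. (A k j - A i j) * \<xi> t j)"
      proof (rule sum_mono)
        fix j assume j: "j \<in> I"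
        have "0 \<le> c * \<xi> t j" using c(1) xi[OF j] by simp
        moreover have "- K * \<xi> t j \<le> (A k j - A i j) * \<xi> t j"
          using K[OF j] xi[OF j] by (intro mult_right_mono) auto
        moreover have "c * \<xi> t j \<le> (A k j - A i j) * \<xi> t j" if "j \<notin> H" "j \<notin> E"
          using c(2) j that xi[OF j] by (intro mult_right_mono) auto
        moreover have "0 \<le> (A k j - A i j) * \<xi> t j" if "j \<notin> E"
          using weak[OF less.prems j] j that xi[OF j] by (auto simp: E_def not_less)
        ultimately show "(if j \<notin> H then c * \<xi> t j else 0) - (if j \<in> E then (c + K) * \<xi> t j else 0)
            \<le> (A k j - A i j) * \<xi> t j"
          by (simp add: distrib_right split: if_split)
      qed
      also have "\<dots> = payoff_against I A k (\<xi> t) - payoff_against I A i (\<xi> t)"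
        by (simp add: payoff_against_def algebra_simps sum_subtractf)
      finally show ?thesis .
    qed
    have "((\<lambda>t. c * d - (c + K) * (\<Sum>j\<in>E. \<xi> t j)) \<longlongrightarrow> c * d - (c + K) * 0) at_top"
      by (intro tendsto_intros E0)
    then have "\<forall>\<^sub>F t in at_top. c * d / 2 < c * d - (c + K) * (\<Sum>j\<in>E. \<xi> t j)"
      by (rule order_tendstoD) (use c(1) d in simp)
    then have "\<forall>\<^sub>F t in at_top.
        payoff_against I A i (\<xi> t) + c * d / 2 \<le> payoff_against I A k (\<xi> t)"
      using eventually_ge_at_top[of 0]
    proof eventually_elim
      case (elim t)
      then show ?case using gap[of t] by linarith
    qed
    then show ?case
      using uniformly_beaten_dies_out[OF fin sol k(1) _ k0, of i "c * d / 2"] less.prems c(1) d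
      by simp
  qed
  have "((\<lambda>t. 1 - (\<Sum>i\<in>I - {k}. \<xi> t i)) \<longlongrightarrow> 1 - 0) at_top"
    using vanish by (intro tendsto_diff tendsto_const tendsto_null_sum)
  moreover have "\<forall>\<^sub>F t in at_top. 1 - (\<Sum>i\<in>I - {k}. \<xi> t i) = \<xi> t k"
    using eventually_ge_at_top[of 0]
  proof eventually_elim
    case (elim t)
    then show ?case
      using taylor_jonker_solutionD(1)[OF sol elim] sum.remove[OF fin k(1), of "\<xi> t"]
      by (simp add: simplex_on_def)
  qed
  ultimately show ?thesis
    using tendsto_cong by force
qed

section \<open>Separation lines and their payoffs\<close>

definition diagonal_line :: "real \<Rightarrow> real \<Rightarrow> (real \<times> real) set" where
  "diagonal_line v m = {(x, y). y = v + m * (x - v)}"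

lemma has_slope_diagonal_line: "has_slope (diagonal_line v m) m"
  unfolding has_slope_def diagonal_line_def
  by (rule exI[of _ "v - m * v"]) (auto simp: algebra_simps)

text \<open>With a nonnegative slope, \<open>(S, T)\<close> and \<open>(R, R)\<close> must be on the upper side, as otherwise
  a nondecreasing line would pass above \<open>(S, T)\<close> and then below \<open>(T, S)\<close>, a point further right
  and lower.  Comparing the two points \<open>(P, P)\<close> and
  \<open>(R, R)\<close> gives \<open>m \<le> 1\<close>, and \<open>m = 1\<close> would force the line to be the diagonal, on which \<open>(R, R)\<close> lies.  The bound
  on \<open>S\<close> records that \<open>(T, S)\<close> is on the lower side.\<close>

lemma separation_line_normal_form:
  assumes "T > R" "R > P" "P > S"
    and sep: "separation_line T R P S l" and slope: "has_slope l m" "0 \<le> m"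
    and not_diag: "(R, R) \<notin> l \<or> m < 1"
  obtains v where "m < 1" "P \<le> v" "v \<le> R" "S \<le> v + m * (T - v)" "l = diagonal_line v m"
proof -
  obtain c where l: "l = {(x, y). y = m * x + c}"
    using slope(1) by (auto simp: has_slope_def)
  obtain a1 a2 b where a: "(a1, a2) \<noteq> (0::real \<times> real)" and lab: "l = {p. (a1, a2) \<bullet> p = b}"
    and side: "a1 * S + a2 * T \<le> b" "a1 * R + a2 * R \<le> b" "a1 * P + a2 * P \<ge> b" "a1 * T + a2 * S \<ge> b"
    using sep unfolding separation_line_def by auto
  have on: "a1 * x + a2 * (m * x + c) = b" for x
  proof -
    have "(x, m * x + c) \<in> l" unfolding l by simp
    then show ?thesis unfolding lab by simp
  qed
  have b: "b = a2 * c" and a1: "a1 = - (a2 * m)"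
    using on[of 0] on[of 1] by (simp_all add: algebra_simps)
  have "a2 \<noteq> 0" using a a1 by (auto simp: zero_prod_def)
  \<comment> \<open>The linear form of the separation is \<open>a2\<close> times the height above the line.\<close>
  have side': "a2 * (T - m * S - c) \<le> 0" "a2 * (R - m * R - c) \<le> 0"
    "a2 * (P - m * P - c) \<ge> 0" "a2 * (S - m * T - c) \<ge> 0"
    using side unfolding a1 b by (simp_all add: algebra_simps)
  have "a2 < 0"
  proof (rule ccontr)
    assume "\<not> a2 < 0"
    then have "0 < a2" using \<open>a2 \<noteq> 0\<close> by simp
    then have "T - m * S - c \<le> 0" "S - m * T - c \<ge> 0"
      using side' by (auto simp: mult_le_0_iff zero_le_mult_iff)
    moreover have "m * S \<le> m * T" using assms by (intro mult_left_mono) auto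
    ultimately show False using assms by linarith
  qed
  then have ineq: "R - m * R \<ge> c" "P - m * P \<le> c" "S \<le> m * T + c"
    using side' by (auto simp: mult_le_0_iff zero_le_mult_iff)
  then have "0 \<le> (1 - m) * (R - P)" by (simp add: algebra_simps)
  then have "m \<le> 1" using assms by (simp add: zero_le_mult_iff)
  have "m \<noteq> 1"
    using not_diag ineq unfolding l by auto
  then have m1: "m < 1" using \<open>m \<le> 1\<close> by simp
  define v where "v = c / (1 - m)"
  have "(1 - m) * v = c" using m1 by (simp add: v_def)
  then have c: "c = v - m * v" by (simp add: algebra_simps)
  show thesis
  proof
    show "m < 1" by fact
    show "P \<le> v" "v \<le> R"
      using ineq m1 by (simp_all add: v_def field_simps)
    show "S \<le> v + m * (T - v)" "l = diagonal_line v m"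
      using ineq(3) unfolding l c diagonal_line_def by (auto simp: algebra_simps)
  qed
qed

lemma payoff_matrix_diagonal_line:
  assumes "l i = diagonal_line v m" "l j = diagonal_line w n" "0 \<le> m" "m < 1" "0 \<le> n" "n < 1"
  shows "payoff_matrix l i j = w + n * (1 - m) / (1 - m * n) * (v - w)"
proof -
  define x where "x = w + n * (1 - m) / (1 - m * n) * (v - w)"
  define y where "y = v + m * (x - v)"
  have "m * n < 1"
    using mult_strict_mono'[of m 1 n 1] assms by simp
  then have x: "(1 - m * n) * (x - w) = n * (1 - m) * (v - w)"
    by (simp add: x_def)
  have "a = v + m * (b - v) \<and> b = w + n * (a - w) \<longleftrightarrow> b = x \<and> a = y" for a b
  proof
    assume ab: "a = v + m * (b - v) \<and> b = w + n * (a - w)"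
    then have "(1 - m * n) * (b - w) = n * (1 - m) * (v - w)" by algebra
    then have "(1 - m * n) * (b - w) = (1 - m * n) * (x - w)" using x by simp
    then have "b = x" using \<open>m * n < 1\<close> by simp
    moreover have "a = v + m * (b - v)" using ab by (rule conjunct1)
    ultimately show "b = x \<and> a = y" by (simp only: y_def simp_thms)
  next
    assume "b = x \<and> a = y"
    moreover have "x = w + n * (y - w)" unfolding y_def using x by algebra
    ultimately show "a = v + m * (b - v) \<and> b = w + n * (a - w)"
      using y_def by (metis (no_types))
  qed
  moreover have "(b, a) \<in> prod.swap ` l j \<longleftrightarrow> (a, b) \<in> l j" for a b
    by force
  ultimately have "(b, a) \<in> l i \<inter> prod.swap ` l j \<longleftrightarrow> (b, a) = (x, y)" for a b
    by (simp only: assms(1,2) diagonal_line_def Int_iff mem_Collect_eq case_prod_conv prod.inject)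
  then have "l i \<inter> prod.swap ` l j = {(x, y)}"
    by (intro set_eqI) (simp only: split_paired_all singleton_iff)
  then show ?thesis
    unfolding x_def by (rule payoff_matrix_eqI(1))
qed

text \<open>The weight of a player's own diagonal value in its payoff.\<close>

lemma response_weight_bounds:
  fixes m n :: real
  assumes "0 \<le> m" "m < 1" "0 \<le> n" "n < 1"
  shows "0 \<le> n * (1 - m) / (1 - m * n)" "0 < n \<Longrightarrow> 0 < n * (1 - m) / (1 - m * n)"
proof -
  have "m * n < 1"
    using mult_strict_mono'[of m 1 n 1] assms by simp
  then show "0 \<le> n * (1 - m) / (1 - m * n)" "0 < n \<Longrightarrow> 0 < n * (1 - m) / (1 - m * n)"
    using assms by simp_all
qed

lemma convex_horizontal_segment:
  fixes C :: "(real \<times> real) set"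
  assumes "convex C" "(a, y) \<in> C" "(b, y) \<in> C" "a \<le> x" "x \<le> b"
  shows "(x, y) \<in> C"
proof -
  have "x \<in> closed_segment a b"
    using assms by (simp add: closed_segment_eq_real_ivl)
  then obtain u where u: "0 \<le> u" "u \<le> 1" "x = (1 - u) *\<^sub>R a + u *\<^sub>R b"
    by (auto simp: closed_segment_def)
  then have "(x, y) = (1 - u) *\<^sub>R (a, y) + u *\<^sub>R (b, y)"
    by (simp add: algebra_simps)
  then show ?thesis
    using convexD_alt[OF assms(1-3) u(1,2)] by simp
qed

text \<open>The point is where the horizontal line at height \<open>h\<close> meets the switch of the line with
  diagonal value \<open>w\<close> and slope \<open>n\<close>.  It lies in the region because, at height \<open>h\<close>, it is to the left
  of the diagonal and to the right of the edge from \<open>(P, P)\<close> to \<open>(S, T)\<close>, both of whose endpoints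
  are on the switched line or to the left of it.\<close>

lemma horizontal_response_in_region:
  assumes "T > R" "R > P" "P > S"
    and h: "P \<le> h" "h \<le> R"
    and w: "P \<le> w" "w \<le> h" and n: "0 \<le> n" "n < 1" and sep: "S \<le> w + n * (T - w)"
  shows "(w + n * (h - w), h) \<in> payoff_region T R P S"
proof -
  let ?C = "payoff_region T R P S"
  have cv: "convex ?C" by (simp add: payoff_region_def)
  have corner: "(R, R) \<in> ?C" "(S, T) \<in> ?C" "(P, P) \<in> ?C"
    by (auto simp: payoff_region_def intro: hull_inc)
  define s where "s = (h - P) / (T - P)"
  have s: "0 \<le> s" "s \<le> 1" "P + s * (T - P) = h"
    using assms by (auto simp: s_def)
  define q where "q = P + s * (S - P)"
  have "(q, h) = (1 - s) *\<^sub>R (P, P) + s *\<^sub>R (S, T)"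
    using s(3) by (auto simp: q_def algebra_simps)
  then have qC: "(q, h) \<in> ?C"
    using convexD_alt[OF cv corner(3,2) s(1,2)] by simp
  define r where "r = (h - P) / (R - P)"
  have r: "0 \<le> r" "r \<le> 1" "P + r * (R - P) = h"
    using assms by (auto simp: r_def)
  have "(h, h) = (1 - r) *\<^sub>R (P, P) + r *\<^sub>R (R, R)"
    using r(3) by (auto simp: algebra_simps)
  then have hC: "(h, h) \<in> ?C"
    using convexD_alt[OF cv corner(3,1) r(1,2)] by simp
  have "q \<le> w + n * (h - w)"
  proof -
    \<comment> \<open>The horizontal distances of the two endpoints from the switched line, interpolated at height \<open>h\<close>.\<close>
    have "0 \<le> (1 - s) * ((1 - n) * (w - P)) + s * (w + n * (T - w) - S)"
      using s n w sep by (intro add_nonneg_nonneg mult_nonneg_nonneg) auto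
    also have "\<dots> = w + n * (P + s * (T - P) - w) - q"
      by (simp add: q_def algebra_simps)
    finally show ?thesis using s(3) by simp
  qed
  moreover have "w + n * (h - w) \<le> h"
    using n w mult_right_mono[of n 1 "h - w"] by simp
  ultimately show ?thesis
    using convex_horizontal_segment[OF cv qC hC] by blast
qed

section \<open>Global stability of fixation\<close>

theorem theorem5p10:
  fixes T R P S :: real
    and I :: "'i set" and k :: 'i
    and \<pi> :: "'i \<Rightarrow> real \<times> real \<Rightarrow> real"
    and l :: "'i \<Rightarrow> (real \<times> real) set"
  assumes "T > R" "R > P" "P > S" "2 * R > T + S"
    and "finite I"
    and "\<And>i. i \<in> I \<Longrightarrow> simple_smale_plan T R P S (l i) (\<pi> i)"
    and "k \<in> I"
    and "(R, R) \<in> l k"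
    and "\<exists>m. has_slope (l k) m \<and> 0 < m \<and> m < 1"
    and "\<And>j. j \<in> I - {k} \<Longrightarrow> (R, R) \<notin> l j"
    and "\<And>i. i \<in> I \<Longrightarrow> \<exists>m. has_slope (l i) m \<and> 0 \<le> m"
    and "\<And>i p. \<lbrakk>i \<in> I; has_slope (l i) 0; p \<in> l i \<inter> payoff_region T R P S\<rbrakk>
           \<Longrightarrow> strictly_below (l k) p"
  shows "taylor_jonker_equilibrium I (payoff_matrix l) (fixation k) \<and>
    (\<forall>\<xi>. taylor_jonker_solution I (payoff_matrix l) \<xi> \<and> \<xi> 0 k > 0
       \<longrightarrow> ((\<lambda>t. \<xi> t k) \<longlongrightarrow> 1) at_top)"
proof -
  have "\<exists>v m. 0 \<le> m \<and> m < 1 \<and> P \<le> v \<and> v \<le> R \<and> S \<le> v + m * (T - v) \<and>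
      l i = diagonal_line v m \<and> (i = k \<longrightarrow> 0 < m)" if i: "i \<in> I" for i
  proof -
    have sep: "separation_line T R P S (l i)"
      using assms(6)[OF i] by (simp add: simple_smale_plan_def)
    obtain m where m: "has_slope (l i) m" "0 \<le> m" "i = k \<longrightarrow> 0 < m \<and> m < 1"
      using assms(9) assms(11)[OF i] less_imp_le by metis
    have "(R, R) \<notin> l i \<or> m < 1" using assms(10)[of i] m(3) i by auto
    then show ?thesis
      using separation_line_normal_form[OF assms(1-3) sep m(1,2)] m by metis
  qed
  then obtain v m where line: "\<And>i. i \<in> I \<Longrightarrow> 0 \<le> m i \<and> m i < 1 \<and> P \<le> v i \<and> v i \<le> R \<and>
      S \<le> v i + m i * (T - v i) \<and> l i = diagonal_line (v i) (m i) \<and> (i = k \<longrightarrow> 0 < m i)"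
    by metis
  have R_on_line: "(R, R) \<in> l i \<longleftrightarrow> v i = R" if "i \<in> I" for i
  proof -
    have li: "l i = diagonal_line (v i) (m i)" and mi: "m i < 1" using line[OF that] by auto
    have "(R, R) \<in> l i \<longleftrightarrow> (1 - m i) * (R - v i) = 0"
      unfolding li by (auto simp: diagonal_line_def algebra_simps)
    then show ?thesis using mi by auto
  qed
  have vk: "v k = R" using R_on_line[OF assms(7)] assms(8) by simp
  have v_less: "v i < R" if "i \<in> I - {k}" for i
    using line[of i] R_on_line[of i] assms(10)[OF that] that by auto
  define W where "W i j = m j * (1 - m i) / (1 - m i * m j)" for i j
  have A: "payoff_matrix l i j = v j + W i j * (v i - v j)" if "i \<in> I" "j \<in> I" for i j
    unfolding W_def using line that by (intro payoff_matrix_diagonal_line) auto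
  have W: "0 \<le> W i j" "0 < m j \<Longrightarrow> 0 < W i j" if "i \<in> I" "j \<in> I" for i j
    using response_weight_bounds[of "m i" "m j"] line that unfolding W_def by auto
  have k_ge: "v j \<le> payoff_matrix l k j" if "j \<in> I" for j
    using A[OF assms(7) that] W[OF assms(7) that] line[OF that] vk by simp
  have lower_le: "payoff_matrix l i j \<le> v j" if "i \<in> I" "j \<in> I" "v i \<le> v j" for i j
    using A[OF that(1,2)] W(1)[OF that(1,2)] that(3) by (simp add: mult_nonneg_nonpos)
  define H where "H = {i \<in> I. m i = 0}"
  have strict: "payoff_matrix l i j < payoff_matrix l k j"
    if i: "i \<in> I - {k}" and j: "j \<in> I - H" and le: "v i \<le> v j" for i j
  proof (cases "j = k")
    case True
    have "0 < W i k * (R - v i)"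
      using W(2)[of i k] v_less[OF i] line[OF assms(7)] i assms(7) by simp
    then show ?thesis
      using A[of i k] A[of k k] i assms(7) vk True by (simp add: algebra_simps)
  next
    case False
    have "0 < m j" using j line[of j] by (auto simp: H_def)
    then have "0 < W k j * (R - v j)"
      using W(2)[of k j] j assms(7) v_less[of j] False by simp
    then have "v j < payoff_matrix l k j"
      using A[of k j] j assms(7) vk by simp
    then show ?thesis using lower_le[of i j] i j le by simp
  qed
  \<comment> \<open>Only opponents with a lower diagonal value require the geometry: there line \<open>h\<close> meets the
    switched line \<open>j\<close> to the left of the diagonal, where slope alone does not keep line \<open>k\<close> above line \<open>h\<close>.\<close>
  have dom: "payoff_matrix l h j \<le> payoff_matrix l k j" if h: "h \<in> I \<inter> H" and j: "j \<in> I" for h j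
  proof (cases "v h \<le> v j")
    case True
    then show ?thesis using lower_le[of h j] k_ge[OF j] h j by simp
  next
    case False
    have mh: "m h = 0" and hI: "h \<in> I" using h by (auto simp: H_def)
    define x where "x = v j + m j * (v h - v j)"
    have "(x, v h) \<in> payoff_region T R P S"
      unfolding x_def using line[OF hI] line[OF j] False assms(1-3)
      by (intro horizontal_response_in_region) auto
    moreover have "(x, v h) \<in> l h" "has_slope (l h) 0"
      using line[OF hI] mh has_slope_diagonal_line[of "v h" 0] by (auto simp: diagonal_line_def)
    ultimately have "strictly_below (l k) (x, v h)"
      using assms(12)[OF hI] by blast
    then have below: "v h < R + m k * (x - R)"
      using line[OF assms(7)] vk by (auto simp: strictly_below_def diagonal_line_def)
    have "m k * m j < 1"
      using line[OF assms(7)] line[OF j] mult_strict_mono'[of "m k" 1 "m j" 1] by simp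
    \<comment> \<open>Comparing heights at abscissa \<open>x\<close> amounts to comparing the payoffs of \<open>k\<close> and \<open>h\<close> against \<open>j\<close>.\<close>
    have "(1 - m k * m j) * (v h - v j) \<le> (1 - m k) * (R - v j)"
      using below by (simp add: x_def algebra_simps)
    then have "v h - v j \<le> (1 - m k) / (1 - m k * m j) * (R - v j)"
      using \<open>m k * m j < 1\<close> by (simp add: field_simps)
    then have "m j * (v h - v j) \<le> m j * ((1 - m k) / (1 - m k * m j) * (R - v j))"
      using line[OF j] by (intro mult_left_mono) auto
    then show ?thesis
      using A[OF hI j] A[OF assms(7) j] mh vk by (simp add: W_def)
  qed
  have "((\<lambda>t. \<xi> t k) \<longlongrightarrow> 1) at_top"
    if "taylor_jonker_solution I (payoff_matrix l) \<xi>" "\<xi> 0 k > 0" for \<xi>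
  proof (rule ranked_elimination[where H = H and v = v, OF assms(5) that(1) assms(7) _ that(2)])
    show "k \<notin> H" using line[OF assms(7)] by (auto simp: H_def)
    show "v i \<le> v k" if "i \<in> I" for i using line[OF that] vk by simp
    show "payoff_matrix l i j \<le> payoff_matrix l k j"
      if "i \<in> I - {k}" "j \<in> I" "v i \<le> v j" for i j
      using lower_le[of i j] k_ge[of j] that by simp
  qed (use strict dom in auto)
  then show ?thesis
    using fixation_equilibrium[OF assms(5,7)] by blast
qed

end
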